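(* Let $a<b$ be real numbers, let $\nu:[a,b]\to[0,\infty)$ be continuous and positive, and let $w:[a,b]\to\mathbb{R}$ be differentiable with $w'(t)=\nu(t)$ on $[a,b]$. Let $p,q:[a,b]\to\mathbb{R}$ be differentiable with $P=\sup_{a<t<b}|p'(t)|<\infty$ and $Q=\sup_{a<t<b}|q'(t)|<\infty$, let $\psi:[0,1]\to[0,1]$ be a function, and let $\lambda\in[0,1]$. For $s,t\in[a,b]$ put $$K(s,t)=\begin{cases} w(s)-\left(w(a)+\psi(\lambda)\frac{w(b)-w(a)}{2}\right), & s\in[a,t),\\[2pt] w(s)-\left(w(a)+(1+\psi(1-\lambda))\frac{w(b)-w(a)}{2}\right), & s\in[t,b].\end{cases}$$ Then $$\begin{aligned} &\Bigg|\big(1+\psi(1-\lambda)-\psi(\lambda)\big)\left(\int_a^b\nu(t)\,dt\right)\left(\int_a^b p(t)q(t)\,dt\right)\\ &\quad+\frac{\psi(\lambda)p(a)+(1-\psi(1-\lambda))p(b)}{2}\left(\int_a^b\nu(t)\,dt\right)\left(\int_a^b q(t)\,dt\right)\\ &\quad+\frac{\psi(\lambda)q(a)+(1-\psi(1-\lambda))q(b)}{2}\left(\int_a^b\nu(t)\,dt\right)\left(\int_a^b p(t)\,dt\right)\\ &\quad-\int_a^b q(t)\left(\int_a^b\nu(s)p(s)\,ds\right)dt-\int_a^b p(t)\left(\int_a^b\nu(s)q(s)\,ds\right)dt\Bigg|\\ &\le\int_a^b\big(P|q(t)|+Q|p(t)|\big)\left(\int_a^b|K(s,t)|\,ds\right)dt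 . \end{aligned}$$
   Context: $[a,b]$ is an ordinary real interval. *)

theory Defs
  imports "HOL-Analysis.Analysis"
begin

text \<open>The argument \<^term>\<open>s\<close> is the variable of integration and \<^term>\<open>t\<close> the node
  at which the kernel jumps. Only the values for \<^prop>\<open>s \<in> {a..b}\<close> and \<^prop>\<open>t \<in> {a..b}\<close>
  are meaningful.\<close>

definition weighted_kernel ::
    "real \<Rightarrow> real \<Rightarrow> (real \<Rightarrow> real) \<Rightarrow> (real \<Rightarrow> real) \<Rightarrow> real \<Rightarrow> real \<Rightarrow> real \<Rightarrow> real"
  where "weighted_kernel a b w \<psi> \<mu> s t =
    (if s < t then w s - (w a + \<psi> \<mu> * ((w b - w a) / 2))
     else w s - (w a + (1 + \<psi> (1 - \<mu>)) * ((w b - w a) / 2)))"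

end

theory Submission
  imports Defs
begin

text \<open>A piecewise integration by parts, for a kernel that jumps by \<^term>\<open>\<alpha> - \<beta>\<close> at \<^term>\<open>t\<close>, gives
  Montgomery's identity, which expresses \<^term>\<open>p t\<close> up to boundary terms as an integral of the kernel
  against the derivative of \<^term>\<open>p\<close>; bounding that derivative by its supremum gives an
  Ostrowski-type estimate. The claim follows by adding \<^term>\<open>q t\<close> times the estimate for \<^term>\<open>p\<close>
  and \<^term>\<open>p t\<close> times the estimate for \<^term>\<open>q\<close> and integrating over \<^term>\<open>t\<close>. The
  Henstock--Kurzweil integral makes this work although the derivatives need not be Riemann
  integrable.\<close>

text \<open>The product rule for \<open>(w s - \<gamma>) * p s\<close> and the fundamental theorem
  give the integral of the sum of two terms. Subtracting the continuous term
  \<open>\<nu> s * p s\<close> then yields integrability of the other one, although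
  \<open>deriv p\<close> may be irregular. The shift \<open>\<gamma>\<close> leaves the derivative
  of \<open>w\<close> unchanged, so each branch of the kernel can use its own.\<close>

lemma integration_by_parts_deriv:
  fixes p w \<nu> :: "real \<Rightarrow> real"
  assumes "c \<le> d" and w: "continuous_on {c..d} w" and p: "continuous_on {c..d} p"
    and \<nu>: "continuous_on {c..d} \<nu>"
    and dw: "\<And>s. s \<in> {c<..<d} \<Longrightarrow> (w has_real_derivative \<nu> s) (at s)"
    and dp: "\<And>s. s \<in> {c<..<d} \<Longrightarrow> p differentiable at s"
  shows "((\<lambda>s. (w s - \<gamma>) * deriv p s) has_integral
           (w d - \<gamma>) * p d - (w c - \<gamma>) * p c - integral {c..d} (\<lambda>s. \<nu> s * p s)) {c..d}"
proof -
  have "((\<lambda>s. \<nu> s * p s + (w s - \<gamma>) * deriv p s) has_integral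
           (w d - \<gamma>) * p d - (w c - \<gamma>) * p c) {c..d}"
  proof (rule fundamental_theorem_of_calculus_interior)
    show "continuous_on {c..d} (\<lambda>s. (w s - \<gamma>) * p s)"
      by (intro continuous_intros w p)
    fix s assume s: "s \<in> {c<..<d}"
    have "(p has_real_derivative deriv p s) (at s)"
      using dp[OF s] by (simp add: DERIV_deriv_iff_real_differentiable)
    then have "((\<lambda>s. (w s - \<gamma>) * p s) has_real_derivative \<nu> s * p s + (w s - \<gamma>) * deriv p s) (at s)"
      using dw[OF s] by (auto intro!: derivative_eq_intros)
    then show "((\<lambda>s. (w s - \<gamma>) * p s) has_vector_derivative \<nu> s * p s + (w s - \<gamma>) * deriv p s) (at s)"
      by (simp add: has_real_derivative_iff_has_vector_derivative)
  qed fact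
  moreover have "((\<lambda>s. \<nu> s * p s) has_integral integral {c..d} (\<lambda>s. \<nu> s * p s)) {c..d}"
    by (intro integrable_integral integrable_continuous_interval continuous_intros \<nu> p)
  ultimately have "((\<lambda>s. (\<nu> s * p s + (w s - \<gamma>) * deriv p s) - \<nu> s * p s) has_integral
      (w d - \<gamma>) * p d - (w c - \<gamma>) * p c - integral {c..d} (\<lambda>s. \<nu> s * p s)) {c..d}"
    by (rule has_integral_diff)
  then show ?thesis
    by simp
qed

lemma has_integral_if_less:
  fixes f g :: "real \<Rightarrow> real"
  assumes "t \<in> {a..b}" and f: "(f has_integral i) {a..t}" and g: "(g has_integral j) {t..b}"
  shows "((\<lambda>s. if s < t then f s else g s) has_integral i + j) {a..b}"
proof (rule has_integral_combine)
  show "((\<lambda>s. if s < t then f s else g s) has_integral i) {a..t}"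
    \<comment> \<open>At \<open>s = t\<close> the conditional takes the value of \<open>g\<close>,
      so only the left piece has an exceptional point.\<close>
    by (rule has_integral_spike_finite[where S = "{t}", OF _ _ f]) auto
  show "((\<lambda>s. if s < t then f s else g s) has_integral j) {t..b}"
    by (rule has_integral_spike_finite[where S = "{}", OF _ _ g]) auto
qed (use assms in auto)

text \<open>Integrate by parts on both sides of \<open>t\<close>, with shift \<alpha> on the left
  and \<beta> on the right. In the two boundary terms at \<open>t\<close> the value
  \<open>w t\<close> cancels, which leaves \<open>(\<beta> - \<alpha>) * p t\<close>.\<close>

lemma montgomery_identity:
  fixes p w \<nu> :: "real \<Rightarrow> real"
  assumes t: "t \<in> {a..b}" and w: "continuous_on {a..b} w" and p: "continuous_on {a..b} p"
    and \<nu>: "continuous_on {a..b} \<nu>"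
    and dw: "\<And>s. s \<in> {a<..<b} \<Longrightarrow> (w has_real_derivative \<nu> s) (at s)"
    and dp: "\<And>s. s \<in> {a<..<b} \<Longrightarrow> p differentiable at s"
  shows "((\<lambda>s. (if s < t then w s - \<alpha> else w s - \<beta>) * deriv p s) has_integral
           (\<beta> - \<alpha>) * p t + (\<alpha> - w a) * p a + (w b - \<beta>) * p b - integral {a..b} (\<lambda>s. \<nu> s * p s)) {a..b}"
proof -
  have "((\<lambda>s. if s < t then (w s - \<alpha>) * deriv p s else (w s - \<beta>) * deriv p s) has_integral
          ((w t - \<alpha>) * p t - (w a - \<alpha>) * p a - integral {a..t} (\<lambda>s. \<nu> s * p s))
          + ((w b - \<beta>) * p b - (w t - \<beta>) * p t - integral {t..b} (\<lambda>s. \<nu> s * p s))) {a..b}"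
    using t by (intro has_integral_if_less integration_by_parts_deriv)
      (auto intro: continuous_on_subset[OF w] continuous_on_subset[OF p] continuous_on_subset[OF \<nu>] dw dp)
  moreover have "integral {a..t} (\<lambda>s. \<nu> s * p s) + integral {t..b} (\<lambda>s. \<nu> s * p s)
      = integral {a..b} (\<lambda>s. \<nu> s * p s)"
    using t by (intro Henstock_Kurzweil_Integration.integral_combine
        integrable_continuous_interval continuous_intros \<nu> p) auto
  moreover have "(\<lambda>s. if s < t then (w s - \<alpha>) * deriv p s else (w s - \<beta>) * deriv p s)
      = (\<lambda>s. (if s < t then w s - \<alpha> else w s - \<beta>) * deriv p s)"
    by auto
  ultimately show ?thesis
    by (simp add: algebra_simps)
qed

lemma abs_step_kernel_has_integral:
  fixes w :: "real \<Rightarrow> real"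
  assumes t: "t \<in> {a..b}" and w: "continuous_on {a..b} w"
  shows "((\<lambda>s. \<bar>if s < t then w s - \<alpha> else w s - \<beta>\<bar>) has_integral
           integral {a..t} (\<lambda>s. \<bar>w s - \<alpha>\<bar>) + integral {t..b} (\<lambda>s. \<bar>w s - \<beta>\<bar>)) {a..b}"
proof -
  have "((\<lambda>s. if s < t then \<bar>w s - \<alpha>\<bar> else \<bar>w s - \<beta>\<bar>) has_integral
           integral {a..t} (\<lambda>s. \<bar>w s - \<alpha>\<bar>) + integral {t..b} (\<lambda>s. \<bar>w s - \<beta>\<bar>)) {a..b}"
    using t by (intro has_integral_if_less integrable_integral integrable_continuous_interval
        continuous_intros continuous_on_subset[OF w]) auto
  then show ?thesis
    by (simp add: if_distrib)
qed

text \<open>Splitting at the jump leaves two integrals of fixed continuous functions, in which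
  \<open>t\<close> occurs only as an endpoint. This continuity makes the right-hand side of the
  final estimate integrable.\<close>

lemma continuous_on_integral_abs_step_kernel:
  fixes w :: "real \<Rightarrow> real"
  assumes w: "continuous_on {a..b} w"
  shows "continuous_on {a..b} (\<lambda>t. integral {a..b} (\<lambda>s. \<bar>if s < t then w s - \<alpha> else w s - \<beta>\<bar>))"
proof -
  have "continuous_on {a..b} (\<lambda>t. integral {a..t} (\<lambda>s. \<bar>w s - \<alpha>\<bar>) + integral {t..b} (\<lambda>s. \<bar>w s - \<beta>\<bar>))"
    by (intro continuous_on_add indefinite_integral_continuous_1 indefinite_integral_continuous_1'
        integrable_continuous_interval continuous_intros w)
  then show ?thesis
    by (rule continuous_on_eq) (rule integral_unique[OF abs_step_kernel_has_integral[OF _ w], symmetric])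
qed

lemma ostrowski_step_kernel:
  fixes p w \<nu> :: "real \<Rightarrow> real"
  assumes t: "t \<in> {a..b}" and w: "continuous_on {a..b} w" and p: "continuous_on {a..b} p"
    and \<nu>: "continuous_on {a..b} \<nu>"
    and dw: "\<And>s. s \<in> {a<..<b} \<Longrightarrow> (w has_real_derivative \<nu> s) (at s)"
    and dp: "\<And>s. s \<in> {a<..<b} \<Longrightarrow> p differentiable at s"
    and P: "\<And>s. s \<in> {a<..<b} \<Longrightarrow> \<bar>deriv p s\<bar> \<le> P"
  shows "\<bar>(\<beta> - \<alpha>) * p t + (\<alpha> - w a) * p a + (w b - \<beta>) * p b - integral {a..b} (\<lambda>s. \<nu> s * p s)\<bar>
    \<le> P * integral {a..b} (\<lambda>s. \<bar>if s < t then w s - \<alpha> else w s - \<beta>\<bar>)"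
proof -
  let ?K = "\<lambda>s. if s < t then w s - \<alpha> else w s - \<beta>"
  \<comment> \<open>Nothing is known about \<open>deriv p\<close> at the endpoints. Replacing it by
    0 there keeps the integral and makes the bound by \<open>P\<close> hold on the whole interval,
    as \<open>P\<close> is nonnegative.\<close>
  define d where "d s = (if s \<in> {a<..<b} then deriv p s else 0)" for s
  have "P \<ge> 0" if "a < b"
    using P[of "(a + b) / 2"] that by auto
  have K: "(\<lambda>s. \<bar>?K s\<bar>) integrable_on {a..b}"
    using abs_step_kernel_has_integral[OF t w] by blast
  have d: "((\<lambda>s. ?K s * d s) has_integral
           (\<beta> - \<alpha>) * p t + (\<alpha> - w a) * p a + (w b - \<beta>) * p b - integral {a..b} (\<lambda>s. \<nu> s * p s)) {a..b}"
    by (rule has_integral_spike_finite[where S = "{a, b}", OF _ _ montgomery_identity[OF t w p \<nu> dw dp]])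
      (auto simp: d_def)
  show ?thesis
  proof (cases "a < b")
    case True
    have "norm (integral {a..b} (\<lambda>s. ?K s * d s)) \<le> integral {a..b} (\<lambda>s. P * \<bar>?K s\<bar>)"
    proof (rule integral_norm_bound_integral)
      fix s
      have "\<bar>?K s\<bar> * \<bar>d s\<bar> \<le> \<bar>?K s\<bar> * P"
        using P[of s] \<open>a < b \<Longrightarrow> P \<ge> 0\<close> True by (intro mult_left_mono) (auto simp: d_def)
      then show "norm (?K s * d s) \<le> P * \<bar>?K s\<bar>"
        by (simp add: abs_mult mult.commute)
    qed (use d K in \<open>auto intro: integrable_on_mult_right\<close>)
    then show ?thesis
      using d by (simp add: integral_unique)
  next
    \<comment> \<open>On a degenerate interval the hypothesis on \<open>P\<close> is vacuous, but
      both sides vanish.\<close>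
    case False
    then have "a = b"
      using t by simp
    then show ?thesis
      using t by (simp add: algebra_simps)
  qed
qed

theorem corollary20:
  fixes a b \<mu> P Q :: real and \<nu> w p q \<psi> :: "real \<Rightarrow> real"
  assumes "a < b"
    and "continuous_on {a..b} \<nu>"
    and "\<And>t. t \<in> {a..b} \<Longrightarrow> 0 < \<nu> t"
    and "\<And>t. t \<in> {a..b} \<Longrightarrow> (w has_real_derivative \<nu> t) (at t within {a..b})"
    and "p differentiable_on {a..b}"
    and "q differentiable_on {a..b}"
    and "bdd_above ((\<lambda>t. \<bar>deriv p t\<bar>) ` {a<..<b})"
    and "P = (SUP t\<in>{a<..<b}. \<bar>deriv p t\<bar>)"
    and "bdd_above ((\<lambda>t. \<bar>deriv q t\<bar>) ` {a<..<b})"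
    and "Q = (SUP t\<in>{a<..<b}. \<bar>deriv q t\<bar>)"
    and "\<psi> ` {0..1} \<subseteq> {0..1}"
    and "\<mu> \<in> {0..1}"
  shows "\<bar>(1 + \<psi> (1 - \<mu>) - \<psi> \<mu>) * integral {a..b} \<nu> * integral {a..b} (\<lambda>t. p t * q t)
      + (\<psi> \<mu> * p a + (1 - \<psi> (1 - \<mu>)) * p b) / 2 * integral {a..b} \<nu> * integral {a..b} q
      + (\<psi> \<mu> * q a + (1 - \<psi> (1 - \<mu>)) * q b) / 2 * integral {a..b} \<nu> * integral {a..b} p
      - integral {a..b} (\<lambda>t. q t * integral {a..b} (\<lambda>s. \<nu> s * p s))
      - integral {a..b} (\<lambda>t. p t * integral {a..b} (\<lambda>s. \<nu> s * q s))\<bar>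
    \<le> integral {a..b} (\<lambda>t. (P * \<bar>q t\<bar> + Q * \<bar>p t\<bar>)
        * integral {a..b} (\<lambda>s. \<bar>weighted_kernel a b w \<psi> \<mu> s t\<bar>))"
proof -
  define \<alpha> where "\<alpha> = w a + \<psi> \<mu> * ((w b - w a) / 2)"
  define \<beta> where "\<beta> = w a + (1 + \<psi> (1 - \<mu>)) * ((w b - w a) / 2)"
  define J where "J t = integral {a..b} (\<lambda>s. \<bar>weighted_kernel a b w \<psi> \<mu> s t\<bar>)" for t
  \<comment> \<open>\<open>M f t\<close> is the value that Montgomery's identity gives for the
    integral of the kernel against \<open>deriv f\<close>.\<close>
  define M where "M f t = (\<beta> - \<alpha>) * f t + (\<alpha> - w a) * f a + (w b - \<beta>) * f b
      - integral {a..b} (\<lambda>s. \<nu> s * f s)" for f t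
  have J_eq: "J = (\<lambda>t. integral {a..b} (\<lambda>s. \<bar>if s < t then w s - \<alpha> else w s - \<beta>\<bar>))"
    unfolding J_def weighted_kernel_def \<alpha>_def \<beta>_def ..
  have dw: "(w has_real_derivative \<nu> s) (at s)" if "s \<in> {a<..<b}" for s
    using assms(4)[of s] that by (simp add: at_within_Icc_at)
  have w: "continuous_on {a..b} w"
    using assms(4) by (meson DERIV_continuous continuous_on_eq_continuous_within)
  have p: "continuous_on {a..b} p" and q: "continuous_on {a..b} q"
    using assms(5,6) by (auto intro: differentiable_imp_continuous_on)
  have J: "continuous_on {a..b} J"
    unfolding J_eq by (rule continuous_on_integral_abs_step_kernel[OF w])
  have I: "integral {a..b} \<nu> = w b - w a"
    using assms(1,4) by (intro integral_unique fundamental_theorem_of_calculus)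
      (auto simp: has_real_derivative_iff_has_vector_derivative)
  have dp: "p differentiable at s" and dq: "q differentiable at s" if "s \<in> {a<..<b}" for s
    using assms(5,6) that by (auto simp: differentiable_on_def at_within_Icc_at dest!: bspec[of _ _ s])
  have P: "\<bar>deriv p s\<bar> \<le> P" and Q: "\<bar>deriv q s\<bar> \<le> Q" if "s \<in> {a<..<b}" for s
    using that assms(7-10) by (auto intro: cSUP_upper)
  have Mp: "\<bar>M p t\<bar> \<le> P * J t" and Mq: "\<bar>M q t\<bar> \<le> Q * J t" if "t \<in> {a..b}" for t
    unfolding M_def J_eq
    using ostrowski_step_kernel[OF that w p assms(2) dw dp P]
      ostrowski_step_kernel[OF that w q assms(2) dw dq Q] by auto
  \<comment> \<open>\<open>Cp\<close> and \<open>Cq\<close> are the parts of \<open>M p t\<close>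
    and \<open>M q t\<close> that do not depend on \<open>t\<close>.\<close>
  define Cp where "Cp = (\<alpha> - w a) * p a + (w b - \<beta>) * p b - integral {a..b} (\<lambda>s. \<nu> s * p s)"
  define Cq where "Cq = (\<alpha> - w a) * q a + (w b - \<beta>) * q b - integral {a..b} (\<lambda>s. \<nu> s * q s)"
  have pq: "(\<lambda>t. p t * q t) integrable_on {a..b}" "p integrable_on {a..b}" "q integrable_on {a..b}"
    by (intro integrable_continuous_interval continuous_intros p q)+
  \<comment> \<open>The factor 2 arises because \<open>q t * M p t\<close> and
    \<open>p t * M q t\<close> each contribute
    \<open>(\<beta> - \<alpha>) * (p t * q t)\<close>.\<close>
  have "((\<lambda>t. 2 * (\<beta> - \<alpha>) * (p t * q t) + Cp * q t + Cq * p t) has_integral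
      2 * (\<beta> - \<alpha>) * integral {a..b} (\<lambda>t. p t * q t) + Cp * integral {a..b} q + Cq * integral {a..b} p) {a..b}"
    by (intro has_integral_add has_integral_mult_right integrable_integral pq)
  moreover have "(\<lambda>t. 2 * (\<beta> - \<alpha>) * (p t * q t) + Cp * q t + Cq * p t) = (\<lambda>t. q t * M p t + p t * M q t)"
    by (simp add: fun_eq_iff M_def Cp_def Cq_def algebra_simps)
  ultimately have E: "((\<lambda>t. q t * M p t + p t * M q t) has_integral
      2 * (\<beta> - \<alpha>) * integral {a..b} (\<lambda>t. p t * q t) + Cp * integral {a..b} q + Cq * integral {a..b} p) {a..b}"
    by simp
  have "norm (integral {a..b} (\<lambda>t. q t * M p t + p t * M q t))
      \<le> integral {a..b} (\<lambda>t. (P * \<bar>q t\<bar> + Q * \<bar>p t\<bar>) * J t)"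
  proof (rule integral_norm_bound_integral)
    show "(\<lambda>t. (P * \<bar>q t\<bar> + Q * \<bar>p t\<bar>) * J t) integrable_on {a..b}"
      by (intro integrable_continuous_interval continuous_intros p q J)
    fix t assume t: "t \<in> {a..b}"
    have "\<bar>q t * M p t + p t * M q t\<bar> \<le> \<bar>q t\<bar> * \<bar>M p t\<bar> + \<bar>p t\<bar> * \<bar>M q t\<bar>"
      by (metis abs_mult abs_triangle_ineq)
    also have "\<dots> \<le> \<bar>q t\<bar> * (P * J t) + \<bar>p t\<bar> * (Q * J t)"
      by (intro add_mono mult_left_mono Mp Mq t) auto
    finally show "norm (q t * M p t + p t * M q t) \<le> (P * \<bar>q t\<bar> + Q * \<bar>p t\<bar>) * J t"
      by (simp add: algebra_simps)
  qed (use E in blast)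
  \<comment> \<open>Since \<open>w b - w a\<close> is the integral of \<nu>, the coefficients of
    \<open>M\<close> become those of the claim. The factor 2 absorbs the half in the kernel's
    shifts.\<close>
  moreover have coeffs: "2 * (\<beta> - \<alpha>) = (1 + \<psi> (1 - \<mu>) - \<psi> \<mu>) * integral {a..b} \<nu>"
    "\<alpha> - w a = \<psi> \<mu> / 2 * integral {a..b} \<nu>" "w b - \<beta> = (1 - \<psi> (1 - \<mu>)) / 2 * integral {a..b} \<nu>"
    unfolding I \<alpha>_def \<beta>_def by (simp_all add: field_simps)
  ultimately show ?thesis
    unfolding integral_unique[OF E] Cp_def Cq_def coeffs J_def
    by (simp add: algebra_simps add_divide_distrib diff_divide_distrib)
qed

end
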